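(* Let $X$ be a separable complex Banach space, let $r\ge 1$, and let $T_1,\ldots,T_r$ be bounded linear operators on $X$. If there is a single (strictly) increasing sequence of positive integers $(n_k)_{k\ge1}$ such that every $T_i$ $(1\le i\le r)$ satisfies the diskcyclic criterion with respect to $(n_k)$, then $T_1\oplus\cdots\oplus T_r$ is $r$-bitransitive.
   Context: $\mathbb{D}=\{z\in\mathbb{C}:|z|\le 1\}$ is the closed unit disk. $\bigoplus_{i=1}^r X$ is the $r$-fold direct sum of $X$ (with any of the usual equivalent norms), and $T_1\oplus\cdots\oplus T_r$ acts on it by $(x_1,\ldots,x_r)\mapsto(T_1x_1,\ldots,T_rx_r)$. For sets $A_i\subset X$, $A_1\oplus\cdots\oplus A_r=\{(a_1,\ldots,a_r):a_i\in A_i\}$. Diskcyclic criterion: a bounded linear operator $T$ on $X$ satisfies the diskcyclic criterion with respect to an increasing sequence of positive integers $(n_k)$ if there exist two dense sets $D,D'\subset X$ and a map $S:D'\to X$ (not assumed linear or continuous) whose iterates are defined on $D'$ (that is, $S(D')\subseteq D'$), such that for all $x\in D$ and $y\in D'$, as $k\to\infty$: (i) $\|T^{n_k}x\|\,\|S^{n_k}y\|\to 0$; (ii) $S^{n_k}y\to 0$; (iii) $T^{n_k}S^{n_k}y\to y$. $k$-bitransitive: an operator $T$ on $\bigoplus_{i=1}^k X$ is $k$-bitransitive if there exist bounded linear operators $T_1,\ldots,T_k$ on $X$ with $T=T_1\oplus\cdots\oplus T_k$ such that for all nonempty open sets $U_1,\ldots,U_k,V_1,\ldots,V_k\subset X$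 there exist a positive integer $n$ and $\alpha_1,\ldots,\alpha_k\in\mathbb{D}\setminus\{0\}$ with $(T_1\oplus\cdots\oplus T_k)^n(\alpha_1U_1\oplus\cdots\oplus\alpha_kU_k)\cap(V_1\oplus\cdots\oplus V_k)\neq\emptyset$. *)

theory Defs
  imports "HOL-Analysis.Analysis"
begin

section \<open>Complex Banach spaces\<close>

text \<open>
  The real scalar multiplication, norm and topology come from the real normed space underlying
  a complex one. The law \<open>1 *\<^sub>C x = x\<close> follows from \<open>scaleR_scaleC\<close>.
\<close>

class complex_normed_vector = real_normed_vector +
  fixes scaleC :: "complex \<Rightarrow> 'a \<Rightarrow> 'a"  (infixr \<open>*\<^sub>C\<close> 75)
  assumes scaleC_add_right: "c *\<^sub>C (x + y) = c *\<^sub>C x + c *\<^sub>C y"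
    and scaleC_add_left: "(c + d) *\<^sub>C x = c *\<^sub>C x + d *\<^sub>C x"
    and scaleC_scaleC: "c *\<^sub>C d *\<^sub>C x = (c * d) *\<^sub>C x"
    and scaleR_scaleC: "t *\<^sub>R x = complex_of_real t *\<^sub>C x"
    and norm_scaleC: "norm (c *\<^sub>C x) = cmod c * norm x"

class complex_banach = complex_normed_vector + banach

instantiation complex :: complex_banach
begin

definition scaleC_complex :: "complex \<Rightarrow> complex \<Rightarrow> complex" where
  "scaleC_complex c x = c * x"

instance
  by standard (simp_all add: scaleC_complex_def algebra_simps norm_mult scaleR_conv_of_real)

end

definition bounded_clinear ::
    "('a::complex_normed_vector \<Rightarrow> 'b::complex_normed_vector) \<Rightarrow> bool" where
  "bounded_clinear f \<longleftrightarrow> bounded_linear f \<and> (\<forall>c x. f (c *\<^sub>C x) = c *\<^sub>C f x)"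


section \<open>Direct sums\<close>

text \<open>
  The \<open>k\<close>-fold direct sum of a space is \<open>'a ^ 'k\<close> with \<open>k = CARD('k)\<close>; its norm is
  the \<open>\<ell>\<^sup>2\<close>-sum of the norms of the components.
\<close>

instantiation vec :: (complex_normed_vector, finite) complex_normed_vector
begin

definition scaleC_vec :: "complex \<Rightarrow> 'a ^ 'b \<Rightarrow> 'a ^ 'b" where
  "scaleC_vec c x = (\<chi> i. c *\<^sub>C (x $ i))"

instance
  by standard
    (simp_all add: scaleC_vec_def vec_eq_iff scaleC_add_right scaleC_add_left scaleC_scaleC
      scaleR_scaleC norm_vec_def norm_scaleC L2_set_right_distrib)

end

instance vec :: (complex_banach, finite) complex_banach ..

definition dsum_op :: "('k::finite \<Rightarrow> 'a \<Rightarrow> 'a) \<Rightarrow> 'a ^ 'k \<Rightarrow> 'a ^ 'k" where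
  "dsum_op T x = (\<chi> i. T i (x $ i))"

definition dsum_set :: "('k::finite \<Rightarrow> 'a set) \<Rightarrow> ('a ^ 'k) set" where
  "dsum_set A = {x. \<forall>i. x $ i \<in> A i}"

lemma bounded_clinear_dsum_op:
  fixes T :: "'k::finite \<Rightarrow> 'a::complex_normed_vector \<Rightarrow> 'a"
  assumes "\<And>i. bounded_clinear (T i)"
  shows "bounded_clinear (dsum_op T)"
proof -
  have lin: "bounded_linear (T i)" and hom: "T i (c *\<^sub>C x) = c *\<^sub>C T i x" for i c x
    using assms by (auto simp: bounded_clinear_def)
  have "\<exists>K. \<forall>x. norm (T i x) \<le> norm x * K" for i
    using bounded_linear.bounded[OF lin] .
  then obtain K where K: "\<And>i x. norm (T i x) \<le> norm x * K i"
    by metis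
  have "bounded_linear (dsum_op T)"
  proof (rule bounded_linear_intro)
    show "dsum_op T (x + y) = dsum_op T x + dsum_op T y" for x y
      by (simp add: dsum_op_def vec_eq_iff linear_simps(1)[OF lin])
    show "dsum_op T (t *\<^sub>R x) = t *\<^sub>R dsum_op T x" for t x
      by (simp add: dsum_op_def vec_eq_iff linear_simps(5)[OF lin])
    show "norm (dsum_op T x) \<le> norm x * (\<Sum>i\<in>UNIV. \<bar>K i\<bar>)" for x
    proof -
      have "norm (T i (x $ i)) \<le> norm x * \<bar>K i\<bar>" for i
      proof -
        have "norm (T i (x $ i)) \<le> norm (x $ i) * K i" by (rule K)
        also have "\<dots> \<le> norm x * \<bar>K i\<bar>"
          by (intro order_trans[OF mult_left_mono mult_right_mono] Finite_Cartesian_Product.norm_nth_le) auto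
        finally show ?thesis .
      qed
      then have "(\<Sum>i\<in>UNIV. norm (dsum_op T x $ i)) \<le> norm x * (\<Sum>i\<in>UNIV. \<bar>K i\<bar>)"
        by (simp add: dsum_op_def sum_distrib_left sum_mono)
      moreover have "norm (dsum_op T x) \<le> (\<Sum>i\<in>UNIV. norm (dsum_op T x $ i))"
        by (simp add: norm_vec_def L2_set_le_sum)
      ultimately show ?thesis by linarith
    qed
  qed
  then show ?thesis
    by (simp add: bounded_clinear_def dsum_op_def scaleC_vec_def vec_eq_iff hom)
qed


section \<open>The diskcyclic criterion and bitransitivity\<close>

text \<open>
  The map \<open>S\<close> is only used on \<open>D'\<close>, so representing \<open>S : D' \<rightarrow> X\<close> by a total function
  is immaterial. Sequences are indexed from \<open>0\<close>.
\<close>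

definition diskcyclic_criterion ::
    "('a::complex_normed_vector \<Rightarrow> 'a) \<Rightarrow> (nat \<Rightarrow> nat) \<Rightarrow> bool" where
  "diskcyclic_criterion T n \<longleftrightarrow>
     bounded_clinear T \<and> strict_mono n \<and> (\<forall>k. 0 < n k) \<and>
     (\<exists>D D' S. closure D = UNIV \<and> closure D' = UNIV \<and> S ` D' \<subseteq> D' \<and>
        (\<forall>x\<in>D. \<forall>y\<in>D'.
           (\<lambda>k. norm ((T ^^ n k) x) * norm ((S ^^ n k) y)) \<longlonglongrightarrow> 0 \<and>
           (\<lambda>k. (S ^^ n k) y) \<longlonglongrightarrow> 0 \<and>
           (\<lambda>k. (T ^^ n k) ((S ^^ n k) y)) \<longlonglongrightarrow> y))"

text \<open>The number \<open>k\<close> in \<open>k\<close>-bitransitivity is \<open>CARD('k)\<close>.\<close>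

definition bitransitive :: "('a::complex_normed_vector ^ 'k \<Rightarrow> 'a ^ 'k) \<Rightarrow> bool" where
  "bitransitive T \<longleftrightarrow>
     bounded_clinear T \<and>
     (\<exists>Ts. (\<forall>i. bounded_clinear (Ts i)) \<and> T = dsum_op Ts \<and>
       (\<forall>U V. (\<forall>i. open (U i) \<and> U i \<noteq> {}) \<and> (\<forall>i. open (V i) \<and> V i \<noteq> {}) \<longrightarrow>
         (\<exists>n>0. \<exists>\<alpha>. (\<forall>i. \<alpha> i \<in> cball (0::complex) 1 - {0}) \<and>
            (dsum_op Ts ^^ n) ` dsum_set (\<lambda>i. (*\<^sub>C) (\<alpha> i) ` U i) \<inter> dsum_set V \<noteq> {})))"

end

theory Submission
  imports Defs
begin

text \<open>
  Perturb \<open>x \<in> D\<close> to \<open>u = x + \<alpha>\<^sup>-\<^sup>1 S\<^sup>n y\<close>, so that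
  \<open>T\<^sup>n (\<alpha> u) = \<alpha> T\<^sup>n x + T\<^sup>n S\<^sup>n y\<close>. The criterion leaves room for a scalar
  \<open>0 < \<alpha> \<le> 1\<close> making both error terms small, for all large \<open>n = n\<^sub>k\<close>; finitely many
  operators sharing the sequence \<open>n\<^sub>k\<close> can therefore be treated with the same power.
\<close>

lemma scaleC_one [simp]: "1 *\<^sub>C (x :: 'a::complex_normed_vector) = x"
  using scaleR_scaleC[of 1 x] by simp

lemma funpow_add_hom:
  fixes f :: "'a::plus \<Rightarrow> 'a"
  assumes "\<And>x y. f (x + y) = f x + f y"
  shows "(f ^^ n) (x + y) = (f ^^ n) x + (f ^^ n) y"
  by (induction n) (simp_all add: assms)

lemma funpow_scaleC_hom:
  fixes f :: "'a::complex_normed_vector \<Rightarrow> 'a"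
  assumes "\<And>x. f (c *\<^sub>C x) = c *\<^sub>C f x"
  shows "(f ^^ n) (c *\<^sub>C x) = c *\<^sub>C (f ^^ n) x"
  by (induction n) (simp_all add: assms)

lemma funpow_dsum_op: "(dsum_op T ^^ n) x = (\<chi> i. (T i ^^ n) (x $ i))"
  by (induction n) (simp_all add: dsum_op_def)

text \<open>For positive \<open>a\<close> the two strict bounds confine \<open>t\<close> to the
  interval from \<open>b / e\<close> to \<open>e / a\<close>, which is nonempty because
  \<open>a * b < e * e\<close>; since \<open>b < e\<close>, it also contains points below 1.\<close>

lemma exists_balancing_scalar:
  fixes a b e :: real
  assumes "0 < e" "0 \<le> b" "b < e" "a * b < e * e"
  obtains t where "0 < t" "t \<le> 1" "t * a < e" "b < e * t"
proof (cases "a < e")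
  case True
  then show ?thesis using that[of 1] assms by simp
next
  case False
  then have a: "0 < a" using assms by simp
  have "b / e < min 1 (e / a)"
    using assms a by (simp add: field_simps)
  then obtain t where t: "b / e < t" "t < min 1 (e / a)"
    using dense by blast
  show ?thesis
  proof (rule that)
    have "0 \<le> b / e" using assms by simp
    then show "0 < t" using t by linarith
    show "t \<le> 1" using t by simp
    show "t * a < e" using t a by (simp add: field_simps)
    show "b < e * t" using t assms by (simp add: field_simps)
  qed
qed

text \<open>The scalar and the vector may vary with \<open>k\<close>. Claiming this for all large
  \<open>k\<close>, not just for one, is what lets several operators share a power.\<close>

lemma diskcyclic_criterion_eventually_meets:
  fixes T :: "'a::complex_normed_vector \<Rightarrow> 'a"
  assumes "diskcyclic_criterion T n"
    and U: "open U" "U \<noteq> {}" and V: "open V" "V \<noteq> {}"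
  shows "\<forall>\<^sub>F k in sequentially.
    \<exists>\<alpha> \<in> cball 0 1 - {0}. \<exists>u\<in>U. (T ^^ n k) (\<alpha> *\<^sub>C u) \<in> V"
proof -
  obtain D D' S where T: "bounded_clinear T"
    and dense: "closure D = UNIV" "closure D' = UNIV"
    and lims: "\<forall>x\<in>D. \<forall>y\<in>D'.
           (\<lambda>k. norm ((T ^^ n k) x) * norm ((S ^^ n k) y)) \<longlonglongrightarrow> 0 \<and>
           (\<lambda>k. (S ^^ n k) y) \<longlonglongrightarrow> 0 \<and>
           (\<lambda>k. (T ^^ n k) ((S ^^ n k) y)) \<longlonglongrightarrow> y"
    using assms(1) unfolding diskcyclic_criterion_def by (elim conjE exE) (rule that)
  have add: "(T ^^ m) (x + y) = (T ^^ m) x + (T ^^ m) y" for m x y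
    using T by (intro funpow_add_hom) (simp add: bounded_clinear_def linear_simps(1))
  have scale: "(T ^^ m) (c *\<^sub>C x) = c *\<^sub>C (T ^^ m) x" for m c x
    using T by (intro funpow_scaleC_hom) (simp add: bounded_clinear_def)
  obtain x where x: "x \<in> D" "x \<in> U"
    using U dense(1) open_Int_closure_eq_empty[of U D] by auto
  obtain y where y: "y \<in> D'" "y \<in> V"
    using V dense(2) open_Int_closure_eq_empty[of V D'] by auto
  obtain d where d: "0 < d" "ball x d \<subseteq> U"
    using U x openE by blast
  obtain d' where d': "0 < d'" "ball y d' \<subseteq> V"
    using V y openE by blast
  \<comment> \<open>In \<open>U\<close> there is one error, of size below \<open>e\<close>; in
    \<open>V\<close> there are two, hence the half of \<open>d'\<close>.\<close>
  define e where "e = min d (d' / 2)"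
  have e: "0 < e" "e \<le> d" "2 * e \<le> d'"
    using d d' by (auto simp: e_def)
  \<comment> \<open>The product is compared with \<open>e * e\<close> and the second factor with
    \<open>e\<close>, as the balancing scalar requires.\<close>
  from lims[rule_format, OF x(1) y(1)]
  have "\<forall>\<^sub>F k in sequentially. norm ((T ^^ n k) x) * norm ((S ^^ n k) y) < e * e"
    and "\<forall>\<^sub>F k in sequentially. norm ((S ^^ n k) y) < e"
    and "\<forall>\<^sub>F k in sequentially. dist ((T ^^ n k) ((S ^^ n k) y)) y < e"
    using e by (auto intro: order_tendstoD(2) tendstoD tendsto_norm_zero)
  then show ?thesis
  proof eventually_elim
    case (elim k)
    let ?w = "(S ^^ n k) y"
    \<comment> \<open>The third bound makes the image of \<open>x\<close> negligible after scaling;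
      the fourth keeps \<open>?w\<close> small even after division by \<open>t\<close>.\<close>
    obtain t where t: "0 < t" "t \<le> 1" "t * norm ((T ^^ n k) x) < e" "norm ?w < e * t"
      using exists_balancing_scalar[of e "norm ?w" "norm ((T ^^ n k) x)"] e elim by auto
    define \<alpha> where "\<alpha> = complex_of_real t"
    have \<alpha>: "\<alpha> \<noteq> 0" "cmod \<alpha> = t"
      using t by (auto simp: \<alpha>_def)
    define u where "u = x + inverse \<alpha> *\<^sub>C ?w"
    have "norm (inverse \<alpha> *\<^sub>C ?w) < e"
      using t \<alpha> by (simp add: norm_scaleC norm_divide field_simps)
    then have "u \<in> U"
      using d e by (intro subsetD[OF d(2)]) (simp add: u_def dist_norm)
    have "\<alpha> *\<^sub>C u = \<alpha> *\<^sub>C x + ?w"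
      using \<alpha> by (simp add: u_def scaleC_add_right scaleC_scaleC)
    then have "(T ^^ n k) (\<alpha> *\<^sub>C u) = \<alpha> *\<^sub>C (T ^^ n k) x + (T ^^ n k) ?w"
      by (simp add: add scale)
    moreover have "norm (\<alpha> *\<^sub>C (T ^^ n k) x) < e"
      using t \<alpha> by (simp add: norm_scaleC)
    \<comment> \<open>The two errors are the scaled image of \<open>x\<close> and the defect of
      \<open>S\<close> as a right inverse at \<open>y\<close>.\<close>
    ultimately have "dist ((T ^^ n k) (\<alpha> *\<^sub>C u)) y < 2 * e"
      using elim(3) norm_triangle_ineq[of "\<alpha> *\<^sub>C (T ^^ n k) x" "(T ^^ n k) ?w - y"]
      by (simp add: dist_norm algebra_simps)
    then have "(T ^^ n k) (\<alpha> *\<^sub>C u) \<in> V"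
      using e by (intro subsetD[OF d'(2)]) (simp add: dist_commute)
    moreover have "\<alpha> \<in> cball 0 1 - {0}"
      using \<alpha> t by simp
    ultimately show ?case using \<open>u \<in> U\<close> by blast
  qed
qed

theorem theorem2p16:
  fixes T :: "'r::finite \<Rightarrow> 'a::complex_banach \<Rightarrow> 'a"
  assumes "separable_space (euclidean :: 'a topology)"
    and "\<And>i. bounded_clinear (T i)"
    and "\<exists>n :: nat \<Rightarrow> nat. strict_mono n \<and> (\<forall>k. 0 < n k) \<and> (\<forall>i. diskcyclic_criterion (T i) n)"
  shows "bitransitive (dsum_op T)"
proof -
  obtain n :: "nat \<Rightarrow> nat" where pos: "\<And>k. 0 < n k"
    and crit: "\<And>i. diskcyclic_criterion (T i) n"
    using assms(3) by blast
  have "\<exists>m>0. \<exists>\<alpha>. (\<forall>i. \<alpha> i \<in> cball (0::complex) 1 - {0}) \<and>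
      (dsum_op T ^^ m) ` dsum_set (\<lambda>i. (*\<^sub>C) (\<alpha> i) ` U i) \<inter> dsum_set V \<noteq> {}"
    if U: "\<forall>i. open (U i) \<and> U i \<noteq> {}" and V: "\<forall>i. open (V i) \<and> V i \<noteq> {}" for U V
  proof -
    \<comment> \<open>The index type is finite, so the thresholds of the individual operators have a
      common upper bound, although their dense sets and right inverses may differ.\<close>
    have "\<forall>\<^sub>F k in sequentially. \<forall>i.
        \<exists>\<alpha> \<in> cball 0 1 - {0}. \<exists>u\<in>U i. (T i ^^ n k) (\<alpha> *\<^sub>C u) \<in> V i"
      using U V
      by (intro eventually_all_finite diskcyclic_criterion_eventually_meets[OF crit]) auto
    then obtain k where
      "\<forall>i. \<exists>\<alpha> \<in> cball 0 1 - {0}. \<exists>u\<in>U i. (T i ^^ n k) (\<alpha> *\<^sub>C u) \<in> V i"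
      using eventually_happens'[OF sequentially_bot] by blast
    then obtain \<alpha> u where \<alpha>: "\<And>i. \<alpha> i \<in> cball 0 1 - {0}" and u: "\<And>i. u i \<in> U i"
      and Tu: "\<And>i. (T i ^^ n k) (\<alpha> i *\<^sub>C u i) \<in> V i"
      by metis
    define z where "z = (\<chi> i. \<alpha> i *\<^sub>C u i)"
    have "z \<in> dsum_set (\<lambda>i. (*\<^sub>C) (\<alpha> i) ` U i)"
      using u by (simp add: z_def dsum_set_def)
    moreover have "(dsum_op T ^^ n k) z \<in> dsum_set V"
      using Tu by (simp add: z_def dsum_set_def funpow_dsum_op)
    ultimately show ?thesis
      using pos \<alpha> by blast
  qed
  then show ?thesis
    unfolding bitransitive_def using assms(2) bounded_clinear_dsum_op[of T]
    by (intro conjI exI[of _ T] allI impI) auto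
qed

end
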